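(* Consider the system of $N\ge 2$ interacting reinforced stochastic processes described in the context, with weighted adjacency matrix $W$ irreducible and diagonalizable (over $\mathbb{C}$), and assume that there exist real constants $\gamma,\nu\in(1/2,1]$ and $c,q>0$ such that $$r_{n-1}=\frac{c}{n^{\gamma}}+O\left(\frac{1}{n^{2\gamma}}\right)\qquad\text{and}\qquad q_{n,n}=\frac{q}{n^{\nu}}+O\left(\frac{1}{n^{2\nu}}\right).$$ Let $Z_\infty$ be the $[0,1]$-valued random variable such that $\mathbf{Z}_n\to Z_\infty\mathbf{1}$ almost surely. Then $$\mathbf{N}_n\longrightarrow Z_\infty\mathbf{1}\qquad\text{almost surely}.$$
   Context: Model. Let $N\ge 2$, $V=\{1,\dots,N\}$, and let $W=[w_{h,j}]_{h,j\in V}$ be a deterministic matrix with $w_{h,j}\ge 0$ and $\sum_{h=1}^N w_{h,j}=1$ for each $j\in V$ (i.e. $W^\top\mathbf{1}=\mathbf{1}$). Let $(r_n)_{n\ge 0}$ be a sequence of real numbers in $(0,1)$ and $(a_k)_{k\ge1}$ a sequence of strictly positive real numbers; set $q_{n,k}:=a_k/\sum_{l=1}^n a_l$ for $1\le k\le n$. On a probability space, let $Z_{0,j}$ ($j\in V$) be random variables with values in $[0,1]$, let $X_{n,j}$ ($n\ge1$, $j\in V$) be random variables with values in $\{0,1\}$, and let $\mathcal{F}_n:=\sigma(Z_{0,h}:h\in V)\vee\sigma(X_{k,j}:1\le k\le n,\,j\in V)$. For every $n\ge 0$ the variables $\{X_{n+1,j}:j\in V\}$ are conditionally independent given $\mathcal{F}_n$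 with $$P(X_{n+1,j}=1\mid\mathcal{F}_n)=\sum_{h=1}^N w_{h,j}Z_{n,h},$$ where, for $n\ge1$, $Z_{n,h}=(1-r_{n-1})Z_{n-1,h}+r_{n-1}X_{n,h}$. The weighted empirical means are $N_{0,j}:=0$ and $N_{n,j}:=\sum_{k=1}^n q_{n,k}X_{k,j}$ for $n\ge 1$. Set $\mathbf{X}_n=(X_{n,1},\dots,X_{n,N})^\top$, $\mathbf{Z}_n=(Z_{n,1},\dots,Z_{n,N})^\top$, $\mathbf{N}_n=(N_{n,1},\dots,N_{n,N})^\top$. $\mathbf{1}$ denotes a vector of all ones. Known fact (earlier work): under the stated assumptions on $W$ and $(r_n)$ there is a random variable $Z_\infty$ with values in $[0,1]$ such that $\mathbf{Z}_n\to Z_\infty\mathbf{1}$ almost surely. *)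

theory Defs
  imports "HOL-Probability.Probability" "HOL-Library.Landau_Symbols"
begin

section \<open>Matrices\<close>

definition irreducible_matrix :: "real^'n^'n \<Rightarrow> bool" where
  "irreducible_matrix A \<longleftrightarrow> (\<forall>i j. (i, j) \<in> {(i, j). A $ i $ j \<noteq> 0}\<^sup>+)"

text \<open>
  Strong connectivity of the associated digraph agrees with the block formulation: no simultaneous
  permutation of rows and columns makes the matrix block triangular. (In dimension one the two
  formulations differ for the zero matrix only.)
\<close>

lemma irreducible_matrix_iff_no_zero_block:
  fixes A :: "real^'n^'n"
  assumes "CARD('n) \<ge> 2"
  shows "irreducible_matrix A \<longleftrightarrow>
    \<not> (\<exists>S. S \<noteq> {} \<and> S \<noteq> UNIV \<and> (\<forall>i\<in>S. \<forall>j\<in>-S. A $ i $ j = 0))"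
proof -
  let ?E = "{(i, j). A $ i $ j \<noteq> 0}"
  have "\<exists>S. S \<noteq> {} \<and> S \<noteq> UNIV \<and> (\<forall>i\<in>S. \<forall>j\<in>-S. A $ i $ j = 0)"
    if not: "\<not> irreducible_matrix A"
  proof -
    from not obtain i j where ij: "(i, j) \<notin> ?E\<^sup>+"
      unfolding irreducible_matrix_def by blast
    define S where "S = {k. (i, k) \<in> ?E\<^sup>+}"
    have closed: "l \<in> S" if "k \<in> S" "A $ k $ l \<noteq> 0" for k l
      using that trancl_into_trancl[of i k ?E l] by (simp add: S_def)
    show ?thesis
    proof (cases "S = {}")
      case False
      moreover have "S \<noteq> UNIV" using ij by (auto simp: S_def)
      moreover have "\<forall>k\<in>S. \<forall>l\<in>-S. A $ k $ l = 0" using closed by blast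
      ultimately show ?thesis by blast
    next
      case True
      have "A $ i $ l = 0" for l
        using True r_into_trancl[of i l ?E] by (auto simp: S_def)
      moreover have "{i} \<noteq> (UNIV :: 'n set)"
      proof
        assume "{i} = (UNIV :: 'n set)"
        then have "CARD('n) = card {i}" by simp
        then show False using assms by simp
      qed
      ultimately show ?thesis by (intro exI[of _ "{i}"]) auto
    qed
  qed
  moreover have "\<not> irreducible_matrix A"
    if S: "S \<noteq> {}" "S \<noteq> UNIV" "\<forall>i\<in>S. \<forall>j\<in>-S. A $ i $ j = 0" for S
  proof
    assume irr: "irreducible_matrix A"
    from S obtain i j where i: "i \<in> S" and j: "j \<notin> S" by blast
    from irr have "(i, j) \<in> ?E\<^sup>+" by (simp add: irreducible_matrix_def)
    then have "j \<in> S"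
    proof (induction rule: trancl_induct)
      case (base y)
      then show ?case using i S(3) by blast
    next
      case (step y z)
      then show ?case using S(3) by blast
    qed
    with j show False by contradiction
  qed
  ultimately show ?thesis by blast
qed

definition diagonalizable_over_complex :: "real^'n^'n \<Rightarrow> bool" where
  "diagonalizable_over_complex A \<longleftrightarrow>
    (\<exists>(P :: complex^'n^'n) D. invertible P \<and> (\<forall>i j. i \<noteq> j \<longrightarrow> D $ i $ j = 0) \<and>
      map_matrix complex_of_real A = P ** D ** matrix_inv P)"

section \<open>Conditional independence\<close>

definition cond_indep_vars ::
  "'a measure \<Rightarrow> 'a measure \<Rightarrow> ('i \<Rightarrow> 'b measure) \<Rightarrow> ('i \<Rightarrow> 'a \<Rightarrow> 'b) \<Rightarrow> 'i set \<Rightarrow> bool" where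
  "cond_indep_vars M F M' X I \<longleftrightarrow>
    (\<forall>i\<in>I. X i \<in> measurable M (M' i)) \<and>
    (\<forall>J\<subseteq>I. J \<noteq> {} \<longrightarrow> finite J \<longrightarrow> (\<forall>A\<in>Pi J (\<lambda>j. sets (M' j)).
      AE \<omega> in M. real_cond_exp M F (indicator (\<Inter>j\<in>J. X j -` A j \<inter> space M)) \<omega> =
        (\<Prod>j\<in>J. real_cond_exp M F (indicator (X j -` A j \<inter> space M)) \<omega>)))"

section \<open>Interacting reinforced stochastic processes\<close>

text \<open>The value \<open>X 0\<close> plays no role; the actions start at time \<open>1\<close>.\<close>

primrec rsp_Z :: "(nat \<Rightarrow> real) \<Rightarrow> ('n \<Rightarrow> 'a \<Rightarrow> real) \<Rightarrow> (nat \<Rightarrow> 'n \<Rightarrow> 'a \<Rightarrow> real) \<Rightarrow>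
    nat \<Rightarrow> 'n \<Rightarrow> 'a \<Rightarrow> real" where
  "rsp_Z r Z0 X 0 h \<omega> = Z0 h \<omega>"
| "rsp_Z r Z0 X (Suc n) h \<omega> = (1 - r n) * rsp_Z r Z0 X n h \<omega> + r n * X (Suc n) h \<omega>"

definition rsp_weight :: "(nat \<Rightarrow> real) \<Rightarrow> nat \<Rightarrow> nat \<Rightarrow> real" where
  "rsp_weight a n k = a k / (\<Sum>l=1..n. a l)"

text \<open>For \<open>n = 0\<close> the sum is empty, so the initial value is \<open>0\<close>.\<close>

definition rsp_N :: "(nat \<Rightarrow> real) \<Rightarrow> (nat \<Rightarrow> 'n \<Rightarrow> 'a \<Rightarrow> real) \<Rightarrow> nat \<Rightarrow> 'n \<Rightarrow> 'a \<Rightarrow> real" where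
  "rsp_N a X n j \<omega> = (\<Sum>k=1..n. rsp_weight a n k * X k j \<omega>)"

definition rsp_filtration :: "'a measure \<Rightarrow> ('n \<Rightarrow> 'a \<Rightarrow> real) \<Rightarrow> (nat \<Rightarrow> 'n \<Rightarrow> 'a \<Rightarrow> real) \<Rightarrow>
    nat \<Rightarrow> 'a measure" where
  "rsp_filtration M Z0 X n = sigma (space M)
    ({Z0 h -` B \<inter> space M | h B. B \<in> sets borel} \<union>
     {X k j -` B \<inter> space M | k j B. k \<in> {1..n} \<and> B \<in> sets borel})"

locale interacting_rsp = prob_space M for M :: "'a measure" +
  fixes W :: "real^'n^'n"
    and r a :: "nat \<Rightarrow> real"
    and Z0 :: "'n \<Rightarrow> 'a \<Rightarrow> real"
    and X :: "nat \<Rightarrow> 'n \<Rightarrow> 'a \<Rightarrow> real"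
  assumes card_ge_2: "CARD('n) \<ge> 2"
    and W_nonneg: "W $ h $ j \<ge> 0"
    and W_column_sum: "(\<Sum>h\<in>UNIV. W $ h $ j) = 1"
    and r_range: "r n \<in> {0<..<1}"
    and a_pos: "k \<ge> 1 \<Longrightarrow> a k > 0"
    and Z0_measurable: "Z0 h \<in> borel_measurable M"
    and Z0_range: "\<omega> \<in> space M \<Longrightarrow> Z0 h \<omega> \<in> {0..1}"
    and X_measurable: "k \<ge> 1 \<Longrightarrow> X k j \<in> borel_measurable M"
    and X_range: "k \<ge> 1 \<Longrightarrow> \<omega> \<in> space M \<Longrightarrow> X k j \<omega> \<in> {0, 1}"
    and X_cond_indep:
      "cond_indep_vars M (rsp_filtration M Z0 X n) (\<lambda>_. borel) (X (Suc n)) UNIV"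
    and X_cond_prob:
      "AE \<omega> in M. real_cond_exp M (rsp_filtration M Z0 X n)
          (indicator {\<omega> \<in> space M. X (Suc n) j \<omega> = 1}) \<omega> =
        (\<Sum>h\<in>UNIV. W $ h $ j * rsp_Z r Z0 X n h \<omega>)"

text \<open>
  The library's conditional expectation is meaningful only for a subalgebra on which the measure is
  sigma-finite.
\<close>

lemma (in interacting_rsp) rsp_filtration_subalgebra:
  "finite_measure_subalgebra M (rsp_filtration M Z0 X n)"
proof
  let ?G = "{Z0 h -` B \<inter> space M | h B. B \<in> sets borel} \<union>
      {X k j -` B \<inter> space M | k j B. k \<in> {1..n} \<and> B \<in> sets borel}"
  have "?G \<subseteq> sets M"
    using Z0_measurable X_measurable by (auto intro: measurable_sets)
  then have "sigma_sets (space M) ?G \<subseteq> sets M"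
    by (rule sets.sigma_sets_subset)
  moreover have "sets (rsp_filtration M Z0 X n) = sigma_sets (space M) ?G"
    unfolding rsp_filtration_def by (rule sets_measure_of) auto
  ultimately have "sets (rsp_filtration M Z0 X n) \<subseteq> sets M"
    by simp
  then show "subalgebra M (rsp_filtration M Z0 X n)"
    by (simp add: subalgebra_def rsp_filtration_def space_measure_of_conv)
qed

end

theory Submission
  imports Defs
begin

text \<open>
  With \<open>q n = a (n+1) / (a 1 + \<dots> + a (n+1))\<close>, the weighted means satisfy
  \<open>N (n+1) = (1 - q n) N n + q n X (n+1)\<close>. Split \<open>X (n+1) = Y n + \<xi> n\<close> with \<open>Y n\<close> the conditional
  expectation of \<open>X (n+1)\<close>. As \<open>Y n\<close> converges to \<open>Zinf\<close> (the columns of \<open>W\<close> sum to one) and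
  \<open>\<Sum>q n = \<infinity>\<close>, the averages of \<open>Y\<close> converge to \<open>Zinf\<close>. The averages \<open>x n\<close> of the noise \<open>\<xi>\<close> satisfy
  \<open>E (x (n+1))\<^sup>2 \<le> (1 - q n) E (x n)\<^sup>2 + (q n)\<^sup>2\<close> by orthogonality, so that \<open>\<Sum>(q n)\<^sup>2 < \<infinity>\<close> yields
  \<open>\<Sum>q n (x n)\<^sup>2 < \<infinity>\<close> almost surely. Since the increments of \<open>x\<close> are \<open>O(q n)\<close>, those of \<open>x\<^sup>3\<close> are
  summable, and \<open>x\<close> converges, necessarily to \<open>0\<close>; no maximal inequality is needed.
\<close>

section \<open>Deterministic recursive averages\<close>

primrec recursive_mean :: "(nat \<Rightarrow> real) \<Rightarrow> (nat \<Rightarrow> real) \<Rightarrow> nat \<Rightarrow> real" where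
  "recursive_mean q y 0 = 0"
| "recursive_mean q y (Suc n) = (1 - q n) * recursive_mean q y n + q n * y n"

lemma recursive_mean_add:
  "recursive_mean q (\<lambda>n. y n + z n) n = recursive_mean q y n + recursive_mean q z n"
proof (induction n)
  case (Suc n)
  then show ?case by (simp add: distrib_left)
qed simp

text \<open>Each step forms a convex combination of the old mean and a new term, and the start value
  0 lies within the bound.\<close>

lemma abs_recursive_mean_le:
  assumes "\<And>n. 0 \<le> q n" "\<And>n. q n \<le> 1" "\<And>n. \<bar>y n\<bar> \<le> B"
  shows "\<bar>recursive_mean q y n\<bar> \<le> B"
proof (induction n)
  case 0
  then show ?case using assms(3)[of 0] by simp
next
  case (Suc n)
  have "\<bar>recursive_mean q y (Suc n)\<bar> \<le> (1 - q n) * \<bar>recursive_mean q y n\<bar> + q n * \<bar>y n\<bar>"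
    using assms(1,2)[of n] by (simp add: abs_triangle_ineq[THEN order_trans] abs_mult)
  also have "\<dots> \<le> (1 - q n) * B + q n * B"
    using assms(1,2)[of n] assms(3)[of n] Suc by (intro add_mono mult_left_mono) auto
  finally show ?case by (simp add: algebra_simps)
qed

lemma partial_sums_at_top:
  fixes q :: "nat \<Rightarrow> real"
  assumes "\<And>n. 0 \<le> q n" "\<not> summable q"
  shows "filterlim (\<lambda>k. \<Sum>i<k. q i) at_top sequentially"
proof (rule ccontr)
  assume "\<not> ?thesis"
  then obtain B where B: "\<not> (\<forall>\<^sub>F k in sequentially. B \<le> (\<Sum>i<k. q i))"
    by (auto simp: filterlim_at_top)
  have "(\<Sum>i<k. q i) \<le> B" for k
  proof (rule ccontr)
    assume k: "\<not> (\<Sum>i<k. q i) \<le> B"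
    have "B \<le> (\<Sum>i<l. q i)" if "l \<ge> k" for l
      using k sum_mono2[of "{..<l}" "{..<k}" q] that assms(1) by auto
    then show False using B by (auto simp: eventually_sequentially)
  qed
  then show False using assms summableI_nonneg_bounded[of q B] by auto
qed

text \<open>A Toeplitz-type argument: a step multiplies the old error by
  \<open>1 - q n <= exp (- q n)\<close>, so the divergence of the sum of \<open>q\<close> wipes out
  any initial error, while the new terms only contribute errors that are eventually small.\<close>

lemma recursive_mean_tendsto:
  assumes q: "\<And>n. 0 \<le> q n" "\<And>n. q n \<le> 1" "\<not> summable q"
    and y: "y \<longlonglongrightarrow> z"
  shows "recursive_mean q y \<longlonglongrightarrow> z"
proof (rule LIMSEQ_I)
  fix \<epsilon> :: real assume \<epsilon>: "\<epsilon> > 0"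
  define e where "e n = \<bar>recursive_mean q y n - z\<bar>" for n
  obtain m where m: "\<And>n. n \<ge> m \<Longrightarrow> \<bar>y n - z\<bar> < \<epsilon> / 2"
    using LIMSEQ_D[OF y, of "\<epsilon> / 2"] \<epsilon> by auto
  have step: "e (Suc n) \<le> (1 - q n) * e n + q n * (\<epsilon> / 2)" if "n \<ge> m" for n
  proof -
    have "recursive_mean q y (Suc n) - z = (1 - q n) * (recursive_mean q y n - z) + q n * (y n - z)"
      by (simp add: algebra_simps)
    then have "e (Suc n) \<le> (1 - q n) * e n + q n * \<bar>y n - z\<bar>"
      unfolding e_def using q(1,2)[of n]
      by (metis abs_mult abs_of_nonneg abs_triangle_ineq diff_ge_0_iff_ge)
    also have "\<dots> \<le> (1 - q n) * e n + q n * (\<epsilon> / 2)"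
      using m[OF that] q(1,2)[of n] by (intro add_mono mult_left_mono) auto
    finally show ?thesis .
  qed
  \<comment> \<open>Iteration of \<open>step\<close> from \<open>m\<close> on:
    \<open>\<epsilon> / 2\<close> is the fixed point of the one-step bound, and only the excess over
    it decays, by the product of the factors \<open>1 - q (m + i)\<close>.\<close>
  have bound: "e (m + k) \<le> \<epsilon> / 2 + e m * exp (- (\<Sum>i<k. q (m + i)))" for k
  proof (induction k)
    case 0
    then show ?case using \<epsilon> by simp
  next
    case (Suc k)
    let ?E = "e m * exp (- (\<Sum>i<k. q (m + i)))"
    have "e (m + Suc k) \<le> (1 - q (m + k)) * e (m + k) + q (m + k) * (\<epsilon> / 2)"
      using step[of "m + k"] by simp
    also have "\<dots> \<le> (1 - q (m + k)) * (\<epsilon> / 2 + ?E) + q (m + k) * (\<epsilon> / 2)"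
      using Suc q(1,2)[of "m + k"] by (intro add_mono mult_left_mono) auto
    also have "\<dots> = \<epsilon> / 2 + (1 - q (m + k)) * ?E"
      by (simp add: algebra_simps)
    also have "\<dots> \<le> \<epsilon> / 2 + exp (- q (m + k)) * ?E"
      using exp_ge_add_one_self[of "- q (m + k)"]
      by (intro add_left_mono mult_right_mono) (auto simp: e_def)
    also have "exp (- q (m + k)) * ?E = e m * exp (- (\<Sum>i<Suc k. q (m + i)))"
      using exp_add[of "- (\<Sum>i<k. q (m + i))" "- q (m + k)"] by simp
    finally show ?case .
  qed
  have "\<not> summable (\<lambda>i. q (m + i))"
    using q(3) by (simp add: add.commute[of m])
  then have "filterlim (\<lambda>k. \<Sum>i<k. q (m + i)) at_top sequentially"
    using q(1) by (intro partial_sums_at_top) auto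
  then have "(\<lambda>k. exp (- (\<Sum>i<k. q (m + i)))) \<longlonglongrightarrow> 0"
    by (intro filterlim_compose[OF exp_at_bot] filterlim_compose[OF filterlim_uminus_at_bot_at_top])
  then have "(\<lambda>k. e m * exp (- (\<Sum>i<k. q (m + i)))) \<longlonglongrightarrow> 0"
    by (rule tendsto_mult_right_zero)
  then obtain K where K: "\<And>k. k \<ge> K \<Longrightarrow> \<bar>e m * exp (- (\<Sum>i<k. q (m + i)))\<bar> < \<epsilon> / 2"
    using \<epsilon> by (metis LIMSEQ_D diff_zero half_gt_zero real_norm_def)
  have "norm (recursive_mean q y n - z) < \<epsilon>" if "n \<ge> m + K" for n
  proof -
    have "K \<le> n - m" "m + (n - m) = n" using that by simp_all
    then show ?thesis using bound[of "n - m"] K[of "n - m"] by (simp add: e_def)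
  qed
  then show "\<exists>n0. \<forall>n\<ge>n0. norm (recursive_mean q y n - z) < \<epsilon>" by blast
qed

text \<open>The cube is chosen because its increments are about \<open>3 * x^2\<close> times those
  of \<open>x\<close>, hence dominated by the summable \<open>q * x^2\<close> up to an error of
  order \<open>q^2\<close>. Being an odd power, it also determines \<open>x\<close> with its
  sign.\<close>

lemma tendsto_0_if_weighted_squares_summable:
  fixes x q :: "nat \<Rightarrow> real"
  assumes q: "\<And>n. 0 \<le> q n" "\<And>n. q n \<le> 1" "\<not> summable q" "summable (\<lambda>n. (q n)\<^sup>2)"
    and x: "summable (\<lambda>n. q n * (x n)\<^sup>2)"
    and incr: "\<And>n. \<bar>x (Suc n) - x n\<bar> \<le> C * q n"
  shows "x \<longlonglongrightarrow> 0"
proof -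
  have cube_incr: "norm (x (Suc n) ^ 3 - x n ^ 3) \<le> \<bar>C\<bar> * (5 * (q n * (x n)\<^sup>2) + 3 * C\<^sup>2 * (q n)\<^sup>2)" for n
  proof -
    define d where "d = x (Suc n) - x n"
    have d2: "d\<^sup>2 \<le> C\<^sup>2 * (q n)\<^sup>2"
      using power_mono[OF incr[of n], of 2] by (simp add: d_def power_mult_distrib)
    have "x (Suc n) = x n + d" by (simp add: d_def)
    then have "x (Suc n) ^ 3 - x n ^ 3 = d * (3 * (x n)\<^sup>2 + 3 * x n * d + d\<^sup>2)"
      by (simp add: power2_eq_square power3_eq_cube algebra_simps)
    \<comment> \<open>The cross term is at most \<open>3/2 * (x^2 + d^2)\<close> in absolute value,
      which gives the coefficients 9/2 and 5/2, rounded up to 5 and 3.\<close>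
    moreover have "\<bar>3 * (x n)\<^sup>2 + 3 * x n * d + d\<^sup>2\<bar> \<le> 5 * (x n)\<^sup>2 + 3 * d\<^sup>2"
    proof -
      have "0 \<le> (x n + d)\<^sup>2" "0 \<le> (x n - d)\<^sup>2" "0 \<le> (x n)\<^sup>2" "0 \<le> d\<^sup>2" by simp_all
      then show ?thesis unfolding power2_sum power2_diff abs_le_iff by linarith
    qed
    ultimately have "norm (x (Suc n) ^ 3 - x n ^ 3) \<le> \<bar>d\<bar> * (5 * (x n)\<^sup>2 + 3 * d\<^sup>2)"
      by (simp add: abs_mult mult_left_mono)
    also have "\<dots> \<le> (\<bar>C\<bar> * q n) * (5 * (x n)\<^sup>2 + 3 * (C\<^sup>2 * (q n)\<^sup>2))"
    proof (intro mult_mono add_mono mult_left_mono d2)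
      have "C * q n \<le> \<bar>C\<bar> * q n" using q(1)[of n] by (intro mult_right_mono) auto
      then show "\<bar>d\<bar> \<le> \<bar>C\<bar> * q n" using incr[of n] by (simp add: d_def)
    qed (use q(1)[of n] in auto)
    also have "\<dots> = \<bar>C\<bar> * (5 * (q n * (x n)\<^sup>2) + 3 * C\<^sup>2 * (q n * (q n)\<^sup>2))"
      by (simp add: algebra_simps)
    also have "\<dots> \<le> \<bar>C\<bar> * (5 * (q n * (x n)\<^sup>2) + 3 * C\<^sup>2 * (q n)\<^sup>2)"
      using q(1,2)[of n] by (intro mult_left_mono add_left_mono) (auto simp: mult_left_le_one_le)
    finally show ?thesis .
  qed
  have "summable (\<lambda>n. x (Suc n) ^ 3 - x n ^ 3)"
    by (rule summable_comparison_test'[OF _ cube_incr])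
      (intro summable_mult summable_add x q(4))
  \<comment> \<open>The partial sums of the increments telescope to
    \<open>x n ^ 3 - x 0 ^ 3\<close>.\<close>
  then have "convergent (\<lambda>n. x n ^ 3)"
    by (simp add: summable_iff_convergent sum_lessThan_telescope[where f = "\<lambda>n. x n ^ 3"]
        convergent_diff_const_right_iff)
  then obtain l where "(\<lambda>n. x n ^ 3) \<longlonglongrightarrow> l"
    by (auto simp: convergent_def)
  then have "(\<lambda>n. root 3 (x n ^ 3)) \<longlonglongrightarrow> root 3 l"
    by (rule tendsto_real_root)
  then have lim: "x \<longlonglongrightarrow> root 3 l"
    by (simp add: odd_real_root_power_cancel)
  have "root 3 l = 0"
  \<comment> \<open>At a nonzero limit \<open>x^2\<close> would eventually exceed a positive
    constant, so that the summable \<open>q * x^2\<close> would dominate a multiple of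
    \<open>q\<close>.\<close>
  proof (rule ccontr)
    assume L: "root 3 l \<noteq> 0"
    define L where "L = (root 3 l)\<^sup>2"
    have L0: "L > 0" using L by (simp add: L_def)
    have "(\<lambda>n. (x n)\<^sup>2) \<longlonglongrightarrow> L" unfolding L_def by (intro tendsto_power lim)
    then have "\<forall>\<^sub>F n in sequentially. L / 2 < (x n)\<^sup>2"
      by (rule order_tendstoD) (use L0 in simp)
    then have "\<forall>\<^sub>F n in sequentially. norm (q n) \<le> 2 / L * (q n * (x n)\<^sup>2)"
    proof eventually_elim
      case (elim n)
      then have "q n * (L / 2) \<le> q n * (x n)\<^sup>2"
        using q(1)[of n] by (intro mult_left_mono) auto
      then show ?case using q(1)[of n] L0 by (simp add: field_simps)
    qed
    then have "summable q"
      by (rule summable_comparison_test_ev) (intro summable_mult x)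
    with q(3) show False by contradiction
  qed
  with lim show ?thesis by simp
qed

section \<open>Almost sure vanishing of the averaged noise\<close>

lemma (in prob_space) recursive_mean_noise_AE_tendsto_0:
  fixes \<xi> :: "nat \<Rightarrow> 'a \<Rightarrow> real"
  assumes q: "\<And>n. 0 \<le> q n" "\<And>n. q n \<le> 1" "\<not> summable q" "summable (\<lambda>n. (q n)\<^sup>2)"
    and meas [measurable]: "\<And>n. \<xi> n \<in> borel_measurable M"
    and bounded: "\<And>n \<omega>. \<omega> \<in> space M \<Longrightarrow> \<bar>\<xi> n \<omega>\<bar> \<le> 1"
    and orth: "\<And>n. expectation (\<lambda>\<omega>. recursive_mean q (\<lambda>k. \<xi> k \<omega>) n * \<xi> n \<omega>) = 0"
  shows "AE \<omega> in M. recursive_mean q (\<lambda>k. \<xi> k \<omega>) \<longlonglongrightarrow> 0"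
proof -
  define x where "x n \<omega> = recursive_mean q (\<lambda>k. \<xi> k \<omega>) n" for n \<omega>
  have x_Suc: "x (Suc n) \<omega> = (1 - q n) * x n \<omega> + q n * \<xi> n \<omega>" for n \<omega>
    by (simp add: x_def)
  have [measurable]: "x n \<in> borel_measurable M" for n
  proof (induction n)
    case 0
    then show ?case by (simp add: x_def)
  next
    case (Suc n)
    then have [measurable]: "x n \<in> borel_measurable M" .
    show ?case unfolding x_Suc by measurable
  qed
  have x_le: "\<bar>x n \<omega>\<bar> \<le> 1" if "\<omega> \<in> space M" for n \<omega>
    unfolding x_def using q(1,2) bounded[OF that] by (rule abs_recursive_mean_le)
  have prod_le: "\<bar>u * v\<bar> \<le> 1" if "\<bar>u\<bar> \<le> 1" "\<bar>v\<bar> \<le> 1" for u v :: real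
    using mult_mono[OF that] by (simp add: abs_mult)
  have int_x2 [intro, simp]: "integrable M (\<lambda>\<omega>. (x n \<omega>)\<^sup>2)" for n
    by (rule integrable_const_bound[of _ 1]) (auto simp: abs_square_le_1 x_le)
  have int_\<xi>2 [intro, simp]: "integrable M (\<lambda>\<omega>. (\<xi> n \<omega>)\<^sup>2)" for n
    by (rule integrable_const_bound[of _ 1]) (auto simp: abs_square_le_1 bounded)
  have int_x\<xi> [intro, simp]: "integrable M (\<lambda>\<omega>. x n \<omega> * \<xi> n \<omega>)" for n
    by (rule integrable_const_bound[of _ 1]) (auto intro!: AE_I2 prod_le x_le bounded)
  define e where "e n = expectation (\<lambda>\<omega>. (x n \<omega>)\<^sup>2)" for n
  have e_nonneg: "e n \<ge> 0" for n by (simp add: e_def)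
  \<comment> \<open>Expanding the square, the cross term vanishes by \<open>orth\<close>, the noise
    has second moment at most 1, and \<open>(1 - q n)^2 <= 1 - q n\<close>. Keeping the first power
    of \<open>1 - q n\<close> leaves the loss \<open>q n * e n\<close> that is summed below.\<close>
  have e_Suc: "e (Suc n) \<le> (1 - q n) * e n + (q n)\<^sup>2" for n
  proof -
    have "e (Suc n) = expectation (\<lambda>\<omega>. (1 - q n)\<^sup>2 * (x n \<omega>)\<^sup>2 + (q n)\<^sup>2 * (\<xi> n \<omega>)\<^sup>2
        + 2 * (1 - q n) * q n * (x n \<omega> * \<xi> n \<omega>))"
      unfolding e_def x_Suc by (intro Bochner_Integration.integral_cong)
        (simp_all add: power2_eq_square algebra_simps)
    also have "\<dots> = (1 - q n)\<^sup>2 * e n + (q n)\<^sup>2 * expectation (\<lambda>\<omega>. (\<xi> n \<omega>)\<^sup>2)"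
      using orth[of n] by (simp add: e_def flip: x_def)
    also have "expectation (\<lambda>\<omega>. (\<xi> n \<omega>)\<^sup>2) \<le> expectation (\<lambda>\<omega>. 1)"
      by (intro integral_mono) (auto simp: abs_square_le_1 bounded)
    also have "expectation (\<lambda>\<omega>. 1 :: real) = 1"
      by (simp add: prob_space)
    also have "(1 - q n)\<^sup>2 * e n \<le> (1 - q n) * e n"
      using q(1,2)[of n] by (intro mult_right_mono e_nonneg) (simp add: power2_eq_square mult_left_le_one_le)
    finally show ?thesis by (simp add: mult_left_mono)
  qed
  \<comment> \<open>Summation of \<open>q i * e i <= e i - e (Suc i) + (q i)^2\<close>, which
    telescopes; the mean starts at 0, so \<open>e 0 = 0\<close>.\<close>
  have partial: "(\<Sum>i<n. q i * e i) + e n \<le> (\<Sum>i<n. (q i)\<^sup>2)" for n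
  proof (induction n)
    case 0
    then show ?case by (simp add: e_def x_def)
  next
    case (Suc n)
    then show ?case using e_Suc[of n] by (simp add: algebra_simps)
  qed
  have qe: "summable (\<lambda>n. q n * e n)"
  proof (rule summableI_nonneg_bounded)
    show "(\<Sum>i<n. q i * e i) \<le> (\<Sum>i. (q i)\<^sup>2)" for n
      using partial[of n] e_nonneg[of n] sum_le_suminf[OF q(4), of "{..<n}"] by simp
  qed (simp add: q(1) e_nonneg)
  \<comment> \<open>Exchanging sum and integral turns the summability of \<open>q n * e n\<close>
    into a finite expectation of the random series, which is therefore finite almost surely.\<close>
  have "(\<integral>\<^sup>+\<omega>. (\<Sum>n. ennreal (q n * (x n \<omega>)\<^sup>2)) \<partial>M) = (\<Sum>n. \<integral>\<^sup>+\<omega>. ennreal (q n * (x n \<omega>)\<^sup>2) \<partial>M)"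
    by (rule nn_integral_suminf) measurable
  also have "\<dots> = (\<Sum>n. ennreal (q n * e n))"
    by (intro suminf_cong, subst nn_integral_eq_integral) (auto simp: e_def q(1))
  also have "\<dots> = ennreal (\<Sum>n. q n * e n)"
    by (rule suminf_ennreal2[OF _ qe]) (simp add: q(1) e_nonneg)
  finally have "(\<integral>\<^sup>+\<omega>. (\<Sum>n. ennreal (q n * (x n \<omega>)\<^sup>2)) \<partial>M) \<noteq> \<infinity>"
    by simp
  then have "AE \<omega> in M. (\<Sum>n. ennreal (q n * (x n \<omega>)\<^sup>2)) \<noteq> \<infinity>"
    by (intro nn_integral_PInf_AE) measurable
  then show ?thesis
  proof (rule AE_mp, intro AE_I2 impI)
    fix \<omega> assume \<omega>: "\<omega> \<in> space M" and fin: "(\<Sum>n. ennreal (q n * (x n \<omega>)\<^sup>2)) \<noteq> \<infinity>"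
    \<comment> \<open>The constant 2 arises because noise and mean are both bounded by 1 and the
      increment is \<open>q n\<close> times their difference.\<close>
    have incr: "\<bar>x (Suc n) \<omega> - x n \<omega>\<bar> \<le> 2 * q n" for n
    proof -
      have "x (Suc n) \<omega> - x n \<omega> = q n * (\<xi> n \<omega> - x n \<omega>)"
        by (simp add: x_Suc algebra_simps)
      moreover have "\<bar>\<xi> n \<omega> - x n \<omega>\<bar> \<le> 2"
        using bounded[OF \<omega>, of n] x_le[OF \<omega>, of n] by linarith
      ultimately show ?thesis
        using mult_left_mono[OF _ q(1)[of n], of "\<bar>\<xi> n \<omega> - x n \<omega>\<bar>" 2] q(1)[of n]
        by (simp add: abs_mult mult.commute)
    qed
    have "summable (\<lambda>n. q n * (x n \<omega>)\<^sup>2)"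
      using fin q(1) by (intro summable_suminf_not_top) auto
    then have "(\<lambda>n. x n \<omega>) \<longlonglongrightarrow> 0"
      by (rule tendsto_0_if_weighted_squares_summable[OF q _ incr])
    then show "recursive_mean q (\<lambda>k. \<xi> k \<omega>) \<longlonglongrightarrow> 0"
      by (simp add: x_def)
  qed
qed

section \<open>Weights of the empirical means\<close>

lemma rsp_weight_bounds:
  assumes "\<And>k. k \<ge> 1 \<Longrightarrow> a k > 0"
  shows "0 \<le> rsp_weight a n n" "rsp_weight a n n \<le> 1"
proof -
  have "0 \<le> rsp_weight a n n \<and> rsp_weight a n n \<le> 1"
  \<comment> \<open>For \<open>n = 0\<close> the denominator is an empty sum, and division by zero
    gives the weight 0.\<close>
  proof (cases "n = 0")
    case False
    then have "0 < a n" "a n \<le> (\<Sum>l=1..n. a l)"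
      using assms by (auto intro!: member_le_sum simp: less_imp_le)
    then show ?thesis by (simp add: rsp_weight_def)
  qed (simp add: rsp_weight_def)
  then show "0 \<le> rsp_weight a n n" "rsp_weight a n n \<le> 1" by simp_all
qed

text \<open>Passing from \<open>n\<close> to \<open>Suc n\<close> rescales all old weights by the
  same ratio of normalizing sums, which equals 1 minus the newest weight. Actions start at time 1,
  hence the shift by \<open>Suc\<close>.\<close>

lemma rsp_N_eq_recursive_mean:
  assumes a: "\<And>k. k \<ge> 1 \<Longrightarrow> a k > 0"
  shows "rsp_N a X n j \<omega> =
    recursive_mean (\<lambda>n. rsp_weight a (Suc n) (Suc n)) (\<lambda>n. X (Suc n) j \<omega>) n"
proof (induction n)
  case 0
  then show ?case by (simp add: rsp_N_def)
next
  case (Suc n)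
  let ?S = "\<lambda>n. \<Sum>l=1..n. a l"
  have S: "?S (Suc n) > 0" by (intro sum_pos) (auto simp: a)
  have weight: "rsp_weight a (Suc n) k = (1 - rsp_weight a (Suc n) (Suc n)) * rsp_weight a n k"
    if "k \<in> {1..n}" for k
  proof -
    \<comment> \<open>The index \<open>k\<close> makes the range nonempty, so \<open>?S n\<close>
      can be cancelled.\<close>
    have "?S n > 0" using that by (intro sum_pos) (auto simp: a)
    moreover have "1 - rsp_weight a (Suc n) (Suc n) = ?S n / ?S (Suc n)"
      using S by (simp add: rsp_weight_def field_simps)
    ultimately show ?thesis by (simp add: rsp_weight_def)
  qed
  have "rsp_N a X (Suc n) j \<omega> = (1 - rsp_weight a (Suc n) (Suc n)) * rsp_N a X n j \<omega>
      + rsp_weight a (Suc n) (Suc n) * X (Suc n) j \<omega>"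
    by (simp add: rsp_N_def sum_distrib_left weight mult.assoc)
  then show ?case using Suc by simp
qed

text \<open>Comparison with p-series: the main term diverges as \<open>\<nu> <= 1\<close>, whereas
  the error term and the square are both of order \<open>n powr (- 2 * \<nu>)\<close>, summable as
  \<open>2 * \<nu> > 1\<close>.\<close>

lemma weights_not_summable_square_summable:
  fixes g :: "nat \<Rightarrow> real"
  assumes \<nu>: "\<nu> \<in> {1/2<..1}" and "q > 0"
    and g: "(\<lambda>n. g n - q / real n powr \<nu>) \<in> O(\<lambda>n. 1 / real n powr (2 * \<nu>))"
  shows "\<not> summable g" "summable (\<lambda>n. (g n)\<^sup>2)"
proof -
  have sum2: "summable (\<lambda>n. norm (1 / real n powr (2 * \<nu>)))"
    using \<nu> summable_real_powr_iff[of "- (2 * \<nu>)"] by (simp add: powr_minus_divide)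
  have diff: "summable (\<lambda>n. g n - q / real n powr \<nu>)"
    by (rule summable_comparison_test_bigo[OF sum2 g])
  show "\<not> summable g"
  proof
    assume "summable g"
    from summable_diff[OF this diff] have "summable (\<lambda>n. q / real n powr \<nu>)" by simp
    then have "summable (\<lambda>n. inverse q * (q / real n powr \<nu>))" by (rule summable_mult)
    then have "summable (\<lambda>n. real n powr (- \<nu>))"
      using \<open>q > 0\<close> by (simp add: powr_minus_divide)
    then show False using \<nu> by (simp add: summable_real_powr_iff)
  qed
  have "(\<lambda>n. 1 / real n powr (2 * \<nu>)) \<in> O(\<lambda>n. 1 / real n powr \<nu>)"
  proof (rule bigoI[of _ 1], rule eventually_sequentiallyI[of 1])
    fix n :: nat assume "1 \<le> n"
    then have "real n powr \<nu> \<le> real n powr (2 * \<nu>)"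
      using \<nu> by (intro powr_mono) auto
    then show "norm (1 / real n powr (2 * \<nu>)) \<le> 1 * norm (1 / real n powr \<nu>)"
      using \<open>1 \<le> n\<close> by (simp add: frac_le)
  qed
  with g have "(\<lambda>n. g n - q / real n powr \<nu>) \<in> O(\<lambda>n. 1 / real n powr \<nu>)"
    by (rule landau_o.big.trans)
  moreover have "(\<lambda>n. q / real n powr \<nu>) \<in> O(\<lambda>n. 1 / real n powr \<nu>)"
    by (rule bigoI[of _ "\<bar>q\<bar>"]) simp
  ultimately have "(\<lambda>n. (g n - q / real n powr \<nu>) + q / real n powr \<nu>) \<in> O(\<lambda>n. 1 / real n powr \<nu>)"
    by (rule sum_in_bigo(1))
  then have "g \<in> O(\<lambda>n. 1 / real n powr \<nu>)" by simp
  then have "(\<lambda>n. (g n)\<^sup>2) \<in> O(\<lambda>n. (1 / real n powr \<nu>)\<^sup>2)"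
    by (rule landau_o.big_power)
  also have "(\<lambda>n. (1 / real n powr \<nu>)\<^sup>2) = (\<lambda>n. 1 / real n powr (2 * \<nu>))"
    by (simp add: power_divide power2_eq_square flip: powr_add)
  finally show "summable (\<lambda>n. (g n)\<^sup>2)"
    by (rule summable_comparison_test_bigo[OF sum2])
qed

section \<open>Adaptedness and orthogonality in the model\<close>

context interacting_rsp
begin

lemma measurable_filtration_Z0: "Z0 h \<in> borel_measurable (rsp_filtration M Z0 X n)"
  unfolding rsp_filtration_def
  by (rule measurableI) (auto simp: space_measure_of_conv intro!: in_measure_of)

lemma measurable_filtration_X:
  assumes "k \<in> {1..n}"
  shows "X k h \<in> borel_measurable (rsp_filtration M Z0 X n)"
  unfolding rsp_filtration_def using assms
  by (intro measurableI) (auto simp: space_measure_of_conv intro!: in_measure_of)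

lemma measurable_filtration_Z:
  "k \<le> n \<Longrightarrow> rsp_Z r Z0 X k h \<in> borel_measurable (rsp_filtration M Z0 X n)"
proof (induction k arbitrary: h)
  case 0
  have "rsp_Z r Z0 X 0 h = Z0 h" by auto
  then show ?case using measurable_filtration_Z0 by simp
next
  case (Suc k)
  have [measurable]: "rsp_Z r Z0 X k h \<in> borel_measurable (rsp_filtration M Z0 X n)"
    "X (Suc k) h \<in> borel_measurable (rsp_filtration M Z0 X n)"
    using Suc by (auto intro: measurable_filtration_X)
  show ?case unfolding rsp_Z.simps by measurable
qed

lemma rsp_Z_range:
  assumes "\<omega> \<in> space M"
  shows "rsp_Z r Z0 X n h \<omega> \<in> {0..1}"
proof (induction n)
  case 0
  then show ?case using Z0_range[OF assms] by simp
next
  case (Suc n)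
  have "X (Suc n) h \<omega> \<in> {0..1}" using X_range[of "Suc n", OF _ assms, of h] by auto
  then show ?case
    using Suc r_range[of n] convex_bound_le[of "rsp_Z r Z0 X n h \<omega>" 1 "X (Suc n) h \<omega>" "1 - r n" "r n"]
    by auto
qed

text \<open>By \<open>X_cond_prob\<close> this is a version of the conditional expectation of
  \<open>X (Suc n) j\<close> given the past; the explicit formula gives bounds at every point and a
  pathwise limit.\<close>

definition cond_mean :: "nat \<Rightarrow> 'n \<Rightarrow> 'a \<Rightarrow> real" where
  "cond_mean n j \<omega> = (\<Sum>h\<in>UNIV. W $ h $ j * rsp_Z r Z0 X n h \<omega>)"

lemma measurable_filtration_cond_mean:
  assumes "k \<le> n"
  shows "cond_mean k j \<in> borel_measurable (rsp_filtration M Z0 X n)"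
proof -
  note measurable_filtration_Z[OF assms, measurable]
  show ?thesis unfolding cond_mean_def by measurable
qed

lemma cond_mean_range:
  assumes "\<omega> \<in> space M"
  shows "cond_mean n j \<omega> \<in> {0..1}"
proof -
  have "cond_mean n j \<omega> \<le> (\<Sum>h\<in>UNIV. W $ h $ j * 1)"
    unfolding cond_mean_def using rsp_Z_range[OF assms] W_nonneg
    by (intro sum_mono mult_left_mono) auto
  moreover have "0 \<le> cond_mean n j \<omega>"
    unfolding cond_mean_def using rsp_Z_range[OF assms] W_nonneg by (intro sum_nonneg) auto
  ultimately show ?thesis using W_column_sum by simp
qed

text \<open>The characteristic property of conditional expectation: a bounded factor known at time
  \<open>n\<close> cannot distinguish the next action from its conditional mean.\<close>

lemma expectation_mult_X_minus_cond_mean: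
  assumes f: "f \<in> borel_measurable (rsp_filtration M Z0 X n)"
    and bounded: "\<And>\<omega>. \<omega> \<in> space M \<Longrightarrow> \<bar>f \<omega>\<bar> \<le> B"
  shows "expectation (\<lambda>\<omega>. f \<omega> * (X (Suc n) j \<omega> - cond_mean n j \<omega>)) = 0"
proof -
  interpret F: finite_measure_subalgebra M "rsp_filtration M Z0 X n"
    by (rule rsp_filtration_subalgebra)
  let ?E = "{\<omega> \<in> space M. X (Suc n) j \<omega> = 1}"
  have [measurable]: "X (Suc n) j \<in> borel_measurable M" by (rule X_measurable) simp
  have [measurable]: "f \<in> borel_measurable M" "cond_mean n j \<in> borel_measurable M"
    by (auto intro: measurable_from_subalg[OF F.subalg] f measurable_filtration_cond_mean)
  \<comment> \<open>An action with values 0 and 1 is the indicator of the event that it equals 1, so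
    the conditional probability serves as its conditional expectation.\<close>
  have ind: "indicator ?E \<omega> = X (Suc n) j \<omega>" if "\<omega> \<in> space M" for \<omega>
    using X_range[of "Suc n", OF _ that, of j] that by (auto simp: indicator_def)
  have bd: "\<bar>f \<omega> * u\<bar> \<le> B" if "\<omega> \<in> space M" "0 \<le> u" "u \<le> 1" for \<omega> u
    using mult_mono[OF bounded[OF that(1)] that(3)] bounded[OF that(1)] that(2) by (simp add: abs_mult)
  have int_X: "integrable M (\<lambda>\<omega>. f \<omega> * X (Suc n) j \<omega>)"
  proof (rule integrable_const_bound[of _ B], intro AE_I2)
    fix \<omega> assume "\<omega> \<in> space M"
    then show "norm (f \<omega> * X (Suc n) j \<omega>) \<le> B"
      using bd[of \<omega> "X (Suc n) j \<omega>"] X_range[of "Suc n" \<omega> j] by auto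
  qed measurable
  have int_Y: "integrable M (\<lambda>\<omega>. f \<omega> * cond_mean n j \<omega>)"
  proof (rule integrable_const_bound[of _ B], intro AE_I2)
    fix \<omega> assume "\<omega> \<in> space M"
    then show "norm (f \<omega> * cond_mean n j \<omega>) \<le> B"
      using bd[of \<omega> "cond_mean n j \<omega>"] cond_mean_range[of \<omega> n j] by auto
  qed measurable
  have int_ind: "integrable M (\<lambda>\<omega>. f \<omega> * indicator ?E \<omega>)"
    using int_X by (rule Bochner_Integration.integrable_cong[THEN iffD1, rotated -1]) (simp_all add: ind)
  have "expectation (\<lambda>\<omega>. f \<omega> * X (Suc n) j \<omega>) = expectation (\<lambda>\<omega>. f \<omega> * indicator ?E \<omega>)"
    by (intro Bochner_Integration.integral_cong) (simp_all add: ind)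
  also have "\<dots> = expectation (\<lambda>\<omega>. f \<omega> * real_cond_exp M (rsp_filtration M Z0 X n) (indicator ?E) \<omega>)"
    by (rule F.real_cond_exp_intg(2)[symmetric, OF int_ind f]) measurable
  also have "\<dots> = expectation (\<lambda>\<omega>. f \<omega> * cond_mean n j \<omega>)"
  proof (rule integral_cong_AE)
    show "AE \<omega> in M. f \<omega> * real_cond_exp M (rsp_filtration M Z0 X n) (indicator ?E) \<omega> = f \<omega> * cond_mean n j \<omega>"
      using X_cond_prob[of n j] by (auto simp: cond_mean_def)
  qed measurable
  finally show ?thesis
    using int_X int_Y by (simp add: right_diff_distrib)
qed

end

section \<open>Convergence of the weighted empirical means\<close>

theorem theorem3p1:
  fixes M :: "'a measure"
    and W :: "real^'n^'n"
    and r a :: "nat \<Rightarrow> real"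
    and Z0 :: "'n \<Rightarrow> 'a \<Rightarrow> real"
    and X :: "nat \<Rightarrow> 'n \<Rightarrow> 'a \<Rightarrow> real"
    and \<gamma> \<nu> c q :: real
    and Zinf :: "'a \<Rightarrow> real"
  assumes model: "interacting_rsp M W r a Z0 X"
    and W_irreducible: "irreducible_matrix W"
    and W_diagonalizable: "diagonalizable_over_complex W"
    and exponents: "\<gamma> \<in> {1/2<..1}" "\<nu> \<in> {1/2<..1}"
    and constants: "c > 0" "q > 0"
    and r_asymp: "(\<lambda>n. r (n - 1) - c / real n powr \<gamma>) \<in> O(\<lambda>n. 1 / real n powr (2 * \<gamma>))"
    and q_asymp: "(\<lambda>n. rsp_weight a n n - q / real n powr \<nu>) \<in> O(\<lambda>n. 1 / real n powr (2 * \<nu>))"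
    and Zinf_measurable: "Zinf \<in> borel_measurable M"
    and Zinf_range: "\<And>\<omega>. \<omega> \<in> space M \<Longrightarrow> Zinf \<omega> \<in> {0..1}"
    and Z_limit: "AE \<omega> in M. (\<lambda>n. \<chi> j. rsp_Z r Z0 X n j \<omega>) \<longlonglongrightarrow> Zinf \<omega> *\<^sub>R (1 :: real^'n)"
  shows "AE \<omega> in M. (\<lambda>n. \<chi> j. rsp_N a X n j \<omega>) \<longlonglongrightarrow> Zinf \<omega> *\<^sub>R (1 :: real^'n)"
proof -
  interpret interacting_rsp M W r a Z0 X by (rule model)
  let ?q = "\<lambda>n. rsp_weight a (Suc n) (Suc n)"
  note weights = weights_not_summable_square_summable[OF exponents(2) constants(2) q_asymp]
  have q: "0 \<le> ?q n" "?q n \<le> 1" for n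
    using rsp_weight_bounds[OF a_pos] by simp_all
  have q_sums: "\<not> summable ?q" "summable (\<lambda>n. (?q n)\<^sup>2)"
    using weights summable_Suc_iff[of "\<lambda>n. rsp_weight a n n"]
      summable_Suc_iff[of "\<lambda>n. (rsp_weight a n n)\<^sup>2"] by auto
  define \<xi> where "\<xi> j n \<omega> = X (Suc n) j \<omega> - cond_mean n j \<omega>" for j n \<omega>
  have \<xi>_bounded: "\<bar>\<xi> j n \<omega>\<bar> \<le> 1" if "\<omega> \<in> space M" for j n \<omega>
    using X_range[of "Suc n", OF _ that, of j] cond_mean_range[OF that, of n j]
    by (auto simp: \<xi>_def)
  \<comment> \<open>The inequality is strict because \<open>\<xi> j k\<close> involves the action at
    time \<open>Suc k\<close>.\<close>
  have \<xi>_filtration: "\<xi> j k \<in> borel_measurable (rsp_filtration M Z0 X n)" if "k < n" for j k n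
    unfolding \<xi>_def using that
    by (intro borel_measurable_diff measurable_filtration_X measurable_filtration_cond_mean) auto
  \<comment> \<open>The mean with index \<open>m\<close> involves only the noise terms below
    \<open>m\<close>, hence actions up to time \<open>m\<close>; it may thus serve as the factor
    known at time \<open>n\<close> in the orthogonality relation.\<close>
  have mean_filtration:
    "(\<lambda>\<omega>. recursive_mean ?q (\<lambda>k. \<xi> j k \<omega>) m) \<in> borel_measurable (rsp_filtration M Z0 X n)"
    if "m \<le> n" for j m n
    using that
  proof (induction m)
    case (Suc m)
    then show ?case
      using \<xi>_filtration[of m n j]
      by (auto intro!: borel_measurable_add borel_measurable_times)
  qed simp
  have noise: "AE \<omega> in M. recursive_mean ?q (\<lambda>k. \<xi> j k \<omega>) \<longlonglongrightarrow> 0" for j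
  proof (rule recursive_mean_noise_AE_tendsto_0[OF q q_sums])
    show "\<xi> j n \<in> borel_measurable M" for n
      using \<xi>_filtration[of n "Suc n" j] rsp_filtration_subalgebra[of "Suc n"]
      by (auto simp: finite_measure_subalgebra_def finite_measure_subalgebra_axioms_def
          intro: measurable_from_subalg)
    show "\<bar>\<xi> j n \<omega>\<bar> \<le> 1" if "\<omega> \<in> space M" for n \<omega>
      using that by (rule \<xi>_bounded)
    show "expectation (\<lambda>\<omega>. recursive_mean ?q (\<lambda>k. \<xi> j k \<omega>) n * \<xi> j n \<omega>) = 0" for n
      unfolding \<xi>_def[of j n]
      by (rule expectation_mult_X_minus_cond_mean[where B = 1])
        (use mean_filtration abs_recursive_mean_le[OF q] \<xi>_bounded in auto)
  qed
  \<comment> \<open>As the vertex set is finite, the exceptional null sets merge into one.\<close>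
  have "AE \<omega> in M. \<forall>j\<in>UNIV. recursive_mean ?q (\<lambda>k. \<xi> j k \<omega>) \<longlonglongrightarrow> 0"
    by (rule AE_finite_allI) (simp_all add: noise)
  with Z_limit show ?thesis
  proof eventually_elim
    case (elim \<omega>)
    have Z: "(\<lambda>n. rsp_Z r Z0 X n h \<omega>) \<longlonglongrightarrow> Zinf \<omega>" for h
      using tendsto_vec_nth[OF elim(1), of h] by simp
    have "(\<lambda>n. rsp_N a X n j \<omega>) \<longlonglongrightarrow> Zinf \<omega>" for j
    proof -
      \<comment> \<open>All coordinates share one limit and each column of \<open>W\<close> sums to
        1, so averaging over the vertices preserves that limit.\<close>
      have "(\<lambda>n. cond_mean n j \<omega>) \<longlonglongrightarrow> (\<Sum>h\<in>UNIV. W $ h $ j * Zinf \<omega>)"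
        unfolding cond_mean_def by (intro tendsto_intros Z)
      then have "(\<lambda>n. cond_mean n j \<omega>) \<longlonglongrightarrow> Zinf \<omega>"
        by (simp add: W_column_sum flip: sum_distrib_right)
      then have "recursive_mean ?q (\<lambda>n. cond_mean n j \<omega>) \<longlonglongrightarrow> Zinf \<omega>"
        by (rule recursive_mean_tendsto[OF q q_sums(1)])
      \<comment> \<open>The recursive mean is additive, so the limits for the conditional means and
        for the noise add up to the one for the actions.\<close>
      from tendsto_add[OF this] elim(2)
      have "(\<lambda>n. recursive_mean ?q (\<lambda>n. cond_mean n j \<omega>) n
          + recursive_mean ?q (\<lambda>n. \<xi> j n \<omega>) n) \<longlonglongrightarrow> Zinf \<omega> + 0"
        by blast
      then show ?thesis
        by (simp add: rsp_N_eq_recursive_mean[OF a_pos] \<xi>_def flip: recursive_mean_add)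
    qed
    then show ?case
      by (intro vec_tendstoI) simp
  qed
qed

end
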